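(* Let $\pi/2\le\alpha<\pi$ and $f\in\mathcal{A}$. Then $f\in\mathcal{MS}(\alpha)$ if and only if $$f(z)*\left\{\frac{z^2}{(1-z)^2}-\frac{z}{1-z}\cdot\frac{1}{2i\sin\alpha}\log\left(\frac{1+e^{i(\theta+\alpha)}}{1+e^{i(\theta-\alpha)}}\right)\right\}\ne0\qquad(z\in\mathbb{U})$$ for every $\theta$ with $0<\theta<2\pi$ and $\theta-\alpha\ne\pi$.
   Context: $\mathbb{U}=\{z\in\mathbb{C}:|z|<1\}$. $\mathcal{A}$ is the class of functions $f(z)=z+\sum_{n=2}^\infty a_nz^n$ that are analytic and univalent in $\mathbb{U}$. For $\pi/2\le\alpha<\pi$, $\mathcal{MS}(\alpha)$ is the class of all $f\in\mathcal{A}$ such that $$1+\frac{\alpha-\pi}{2\sin\alpha}<\Re\left(\frac{zf'(z)}{f(z)}\right)<1+\frac{\alpha}{2\sin\alpha}\qquad(z\in\mathbb{U}),$$ where $zf'(z)/f(z)$ is given the value $1$ at $z=0$. The symbol $*$ is the Hadamard product (convolution): for $g(z)=\sum_{n\ge0} g_nz^n$ and $h(z)=\sum_{n\ge0} h_nz^n$ analytic in $\mathbb{U}$, $(g*h)(z)=\sum_{n\ge0} g_nh_nz^n$. The logarithm is the principal branch.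
   Formalization: The non-vanishing is required only for z in U with z ≠ 0, since the convolution is always 0 at z = 0 (so f(z)=z would refute the literal claim), and θ+α = π is also excluded, since the logarithm would be log 0 there. *)

theory Defs
  imports "HOL-Complex_Analysis.Complex_Analysis"
begin

definition class_A :: "(complex \<Rightarrow> complex) set" where
  "class_A = {f. f analytic_on ball 0 1 \<and> inj_on f (ball 0 1) \<and>
     (\<exists>a. a 0 = 0 \<and> a 1 = 1 \<and> (\<forall>z\<in>ball 0 1. (\<lambda>n. a n * z ^ n) sums f z))}"

text \<open>The quotient $z f'(z)/f(z)$ with its removable singularity at \<open>0\<close> filled in; for
  \<open>f\<close> in \<^const>\<open>class_A\<close> it has no other singularity in the disc, since \<open>f\<close> is injective
  with \<open>f 0 = 0\<close>.\<close>
definition starlike_quotient :: "(complex \<Rightarrow> complex) \<Rightarrow> complex \<Rightarrow> complex" where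
  "starlike_quotient f z = (if z = 0 then 1 else z * deriv f z / f z)"

definition class_MS :: "real \<Rightarrow> (complex \<Rightarrow> complex) set" where
  "class_MS \<alpha> = {f \<in> class_A. \<forall>z\<in>ball 0 1.
     1 + (\<alpha> - pi) / (2 * sin \<alpha>) < Re (starlike_quotient f z) \<and>
     Re (starlike_quotient f z) < 1 + \<alpha> / (2 * sin \<alpha>)}"

text \<open>For functions analytic in the unit disc, \<^const>\<open>fps_expansion\<close> at \<open>0\<close> is the Taylor series.\<close>
definition hadamard_product ::
  "(complex \<Rightarrow> complex) \<Rightarrow> (complex \<Rightarrow> complex) \<Rightarrow> complex \<Rightarrow> complex" where
  "hadamard_product g h z =
     (\<Sum>n. fps_nth (fps_expansion g 0) n * fps_nth (fps_expansion h 0) n * z ^ n)"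

lemma fps_nth_fps_expansion_sums:
  fixes a :: "nat \<Rightarrow> complex"
  assumes "\<And>z. z \<in> ball 0 1 \<Longrightarrow> (\<lambda>n. a n * z ^ n) sums g z"
  shows "fps_nth (fps_expansion g 0) n = a n"
proof -
  have "conv_radius a \<ge> 1"
  proof (rule conv_radius_geI_ex)
    fix r :: real assume "0 < r" "ereal r < 1"
    then show "\<exists>z. norm z = r \<and> summable (\<lambda>n. a n * z ^ n)"
      using assms[of "of_real r"] by (intro exI[of _ "of_real r"]) (auto simp: sums_iff)
  qed
  then have "fps_conv_radius (Abs_fps a) > 0"
    by (auto simp: fps_conv_radius_def intro: less_le_trans[of _ 1])
  moreover have "eventually (\<lambda>z. eval_fps (Abs_fps a) z = g z) (nhds 0)"
    using assms by (intro eventually_nhds_in_open[THEN eventually_mono, of "ball 0 1"])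
      (auto simp: eval_fps_def sums_iff)
  ultimately have "g has_fps_expansion Abs_fps a"
    by (simp add: has_fps_expansion_def)
  from fps_nth_fps_expansion[OF this, of n] show ?thesis
    by (simp add: fps_expansion_def)
qed

lemma hadamard_product_sums:
  fixes a b :: "nat \<Rightarrow> complex"
  assumes g: "\<And>z. z \<in> ball 0 1 \<Longrightarrow> (\<lambda>n. a n * z ^ n) sums g z"
    and h: "\<And>z. z \<in> ball 0 1 \<Longrightarrow> (\<lambda>n. b n * z ^ n) sums h z"
    and z: "z \<in> ball 0 1"
  shows "(\<lambda>n. a n * b n * z ^ n) sums hadamard_product g h z"
proof -
  obtain w :: real where w: "0 < w" "w < 1" "norm z < w * w"
  proof
    define s where "s = (1 + norm z) / 2"
    show "sqrt s > 0" "sqrt s < 1" "norm z < sqrt s * sqrt s"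
      using z by (auto simp: s_def add_pos_nonneg)
  qed
  have "summable (\<lambda>n. a n * of_real w ^ n)" "summable (\<lambda>n. b n * of_real w ^ n)"
    using w g[of "of_real w"] h[of "of_real w"] by (auto simp: sums_iff)
  then have "Bseq (\<lambda>n. a n * of_real w ^ n)" "Bseq (\<lambda>n. b n * of_real w ^ n)"
    by (auto dest: summable_LIMSEQ_zero convergentI intro: convergent_imp_Bseq)
  then have "Bseq (\<lambda>n. (a n * of_real w ^ n) * (b n * of_real w ^ n))"
    by (rule Bseq_mult)
  then obtain K where K: "\<And>n. norm ((a n * of_real w ^ n) * (b n * of_real w ^ n)) \<le> K"
    by (auto simp: Bseq_def)
  have eq: "a n * b n * z ^ n =
      (a n * of_real w ^ n) * (b n * of_real w ^ n) * (z / of_real (w * w)) ^ n" for n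
    using w by (simp add: power_divide power_mult_distrib)
  have "summable (\<lambda>n. a n * b n * z ^ n)"
  proof (rule summable_comparison_test')
    show "summable (\<lambda>n. K * (norm z / (w * w)) ^ n)"
      using w by (intro summable_mult summable_geometric) auto
    show "norm (a n * b n * z ^ n) \<le> K * (norm z / (w * w)) ^ n" if "n \<ge> 0" for n
    proof -
      have "norm (a n * b n * z ^ n) =
          norm ((a n * of_real w ^ n) * (b n * of_real w ^ n)) * (norm z / (w * w)) ^ n"
        unfolding eq using w by (simp add: norm_mult norm_power norm_divide)
      also have "\<dots> \<le> K * (norm z / (w * w)) ^ n"
        using w by (intro mult_right_mono K) auto
      finally show ?thesis .
    qed
  qed
  moreover have "fps_nth (fps_expansion g 0) n = a n" for n
    using g by (rule fps_nth_fps_expansion_sums)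
  moreover have "fps_nth (fps_expansion h 0) n = b n" for n
    using h by (rule fps_nth_fps_expansion_sums)
  ultimately show ?thesis
    by (simp add: hadamard_product_def summable_sums)
qed

end

theory Submission
  imports Defs
begin

text \<open>
  Write \<open>B \<theta>\<close> for the factor multiplying \<open>- w / (1 - w)\<close>. Convolution with \<open>w / (1 - w)\<close> reproduces
  \<open>f\<close> and convolution with \<open>w\<^sup>2 / (1 - w)\<^sup>2\<close> gives \<open>z f' - f\<close>, so the convolution in the theorem is
  \<open>z f' z - f z - B \<theta> * f z\<close>. For \<open>z \<noteq> 0\<close> it vanishes exactly when \<open>z f' z / f z - 1 = B \<theta>\<close>.

  The numbers \<open>B \<theta>\<close> are the boundary values of the conformal map
  \<open>w \<mapsto> log ((1 + w e\<^sup>i\<^sup>\<alpha>) / (1 + w e\<^sup>-\<^sup>i\<^sup>\<alpha>)) / (2 i sin \<alpha>)\<close> of the disc onto the strip that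
  defines the class. As \<open>1 + e\<^sup>i\<^sup>x = 2 cos (x/2) e\<^sup>i\<^sup>x\<^sup>/\<^sup>2\<close>, the argument of the logarithm is
  \<open>e\<^sup>i\<^sup>\<alpha>\<close> times a real number \<open>r\<close>, and \<open>B \<theta>\<close> lies on the right or on the left edge of the strip
  according to the sign of \<open>r\<close>. Over the admissible angles \<open>r\<close> takes every real value
  except \<open>0\<close> and \<open>1\<close>; the value \<open>1\<close> belongs to the excluded angle \<open>\<theta> = 0\<close>. So \<open>B\<close> covers both edges
  apart from the single point \<open>\<alpha> / (2 sin \<alpha>\<close>) (lemma \<open>strip_edge_image\<close>).

  It remains to see that a holomorphic function on the disc which has the value \<open>0\<close> inside the strip
  at the origin and avoids the punctured edges stays inside the strip. By connectedness it could
  leave only across an edge, hence only through the puncture; but a nonconstant holomorphic function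
  is open, so if it hit the puncture it would hit neighbouring points of that edge as well
  (lemma \<open>holomorphic_stays_in_strip\<close>).
\<close>

section \<open>Boundary values of the strip map\<close>

definition strip_edge :: "real \<Rightarrow> real \<Rightarrow> complex" where
  "strip_edge \<alpha> \<theta> = 1 / (2 * \<i> * complex_of_real (sin \<alpha>)) *
     Ln ((1 + exp (\<i> * complex_of_real (\<theta> + \<alpha>))) / (1 + exp (\<i> * complex_of_real (\<theta> - \<alpha>))))"

definition admissible_angles :: "real \<Rightarrow> real set" where
  "admissible_angles \<alpha> = {\<theta>. 0 < \<theta> \<and> \<theta> < 2 * pi \<and> \<theta> - \<alpha> \<noteq> pi \<and> \<theta> + \<alpha> \<noteq> pi}"

lemma one_plus_exp_i:
  "1 + exp (\<i> * complex_of_real x) = complex_of_real (2 * cos (x / 2)) * exp (\<i> * complex_of_real (x / 2))"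
proof -
  have "cos x = 2 * (cos (x / 2))\<^sup>2 - 1" "sin x = 2 * sin (x / 2) * cos (x / 2)"
    using cos_double_cos[of "x / 2"] sin_double[of "x / 2"] by simp_all
  then show ?thesis
    unfolding cis_conv_exp[symmetric] by (simp add: complex_eq_iff power2_eq_square)
qed

lemma edge_quotient:
  "(1 + exp (\<i> * complex_of_real (\<theta> + \<alpha>))) / (1 + exp (\<i> * complex_of_real (\<theta> - \<alpha>))) =
     complex_of_real (cos ((\<theta> + \<alpha>) / 2) / cos ((\<theta> - \<alpha>) / 2)) * exp (\<i> * complex_of_real \<alpha>)"
proof -
  have "exp (\<i> * complex_of_real ((\<theta> + \<alpha>) / 2)) =
      exp (\<i> * complex_of_real ((\<theta> - \<alpha>) / 2)) * exp (\<i> * complex_of_real \<alpha>)"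
    by (simp add: exp_add[symmetric] algebra_simps add_divide_distrib diff_divide_distrib)
  then show ?thesis
    unfolding one_plus_exp_i by simp
qed

text \<open>For negative \<open>r\<close> the argument of \<open>r * e\<^sup>i\<^sup>\<alpha>\<close> is \<open>\<alpha> - pi\<close> rather than \<open>\<alpha> + pi\<close>, because
  \<open>0 < \<alpha>\<close> pushes the latter out of the principal range.\<close>
lemma Ln_real_mult_exp_i:
  assumes "0 < \<alpha>" "\<alpha> < pi" "r \<noteq> 0"
  shows "Ln (complex_of_real r * exp (\<i> * complex_of_real \<alpha>)) =
    complex_of_real (ln \<bar>r\<bar>) + \<i> * complex_of_real (if 0 < r then \<alpha> else \<alpha> - pi)"
proof (rule Ln_unique)
  have "exp (complex_of_real (ln \<bar>r\<bar>)) = complex_of_real \<bar>r\<bar>"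
    unfolding exp_of_real using assms by simp
  moreover have "exp (\<i> * complex_of_real (\<alpha> - pi)) = - exp (\<i> * complex_of_real \<alpha>)"
    by (simp add: exp_diff right_diff_distrib exp_pi_i')
  ultimately show "exp (complex_of_real (ln \<bar>r\<bar>) +
      \<i> * complex_of_real (if 0 < r then \<alpha> else \<alpha> - pi)) =
      complex_of_real r * exp (\<i> * complex_of_real \<alpha>)"
    using assms by (simp add: exp_add abs_if)
qed (use assms in auto)

lemma strip_edge_eq:
  fixes \<alpha> \<theta> :: real
  defines "r \<equiv> cos ((\<theta> + \<alpha>) / 2) / cos ((\<theta> - \<alpha>) / 2)"
  assumes "0 < \<alpha>" "\<alpha> < pi" "r \<noteq> 0"
  shows "strip_edge \<alpha> \<theta> =
    Complex ((if 0 < r then \<alpha> else \<alpha> - pi) / (2 * sin \<alpha>)) (- ln \<bar>r\<bar> / (2 * sin \<alpha>))"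
proof -
  have "sin \<alpha> > 0"
    using assms by (simp add: sin_gt_zero)
  then show ?thesis
    unfolding strip_edge_def edge_quotient r_def[symmetric] Ln_real_mult_exp_i[OF assms(2-4)]
    by (simp add: complex_eq_iff Re_divide Im_divide power2_eq_square field_simps)
qed

text \<open>With \<open>\<theta> = pi - 2 * \<phi>\<close> the equation \<open>cos ((\<theta> + \<alpha>) / 2) = r * cos ((\<theta> - \<alpha>) / 2)\<close> becomes
  \<open>sin (\<phi> - \<alpha> / 2) = r * sin (\<phi> + \<alpha> / 2)\<close>, which is linear in \<open>tan \<phi>\<close>.\<close>
lemma edge_ratio_surj:
  assumes "0 < \<alpha>" "\<alpha> < pi" "r \<noteq> 0" "r \<noteq> 1"
  obtains \<theta> where "\<theta> \<in> admissible_angles \<alpha>" "cos ((\<theta> + \<alpha>) / 2) / cos ((\<theta> - \<alpha>) / 2) = r"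
proof
  define \<beta> where "\<beta> = \<alpha> / 2"
  define \<phi> where "\<phi> = arctan ((1 + r) / (1 - r) * tan \<beta>)"
  define \<theta> where "\<theta> = pi - 2 * \<phi>"
  have \<beta>: "0 < \<beta>" "\<beta> < pi / 2"
    using assms by (auto simp: \<beta>_def)
  then have pos: "cos \<beta> > 0" "sin \<beta> > 0"
    by (auto intro: cos_gt_zero sin_gt_zero)
  have \<phi>: "- (pi / 2) < \<phi>" "\<phi> < pi / 2"
    unfolding \<phi>_def using arctan_bounded by auto
  then have cos: "cos \<phi> > 0"
    by (simp add: cos_gt_zero_pi)
  have "sin \<phi> / cos \<phi> = (1 + r) / (1 - r) * (sin \<beta> / cos \<beta>)"
    unfolding \<phi>_def using tan_arctan by (simp add: tan_def)
  then have prod: "sin \<phi> * cos \<beta> = (1 + r) / (1 - r) * (cos \<phi> * sin \<beta>)"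
    using pos cos assms by (simp add: field_simps)
  have num: "cos ((\<theta> + \<alpha>) / 2) = 2 * r / (1 - r) * (cos \<phi> * sin \<beta>)"
  proof -
    have "cos ((\<theta> + \<alpha>) / 2) = cos (pi / 2 - (\<phi> - \<beta>))"
      by (simp add: \<theta>_def \<beta>_def field_simps)
    also have "\<dots> = sin \<phi> * cos \<beta> - cos \<phi> * sin \<beta>"
      by (simp add: cos_diff[of "pi / 2"] sin_diff)
    also have "\<dots> = ((1 + r) / (1 - r) - 1) * (cos \<phi> * sin \<beta>)"
      unfolding prod by (simp add: algebra_simps)
    also have "(1 + r) / (1 - r) - 1 = 2 * r / (1 - r)"
      using assms by (simp add: field_simps)
    finally show ?thesis .
  qed
  have den: "cos ((\<theta> - \<alpha>) / 2) = 2 / (1 - r) * (cos \<phi> * sin \<beta>)"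
  proof -
    have "cos ((\<theta> - \<alpha>) / 2) = cos (pi / 2 - (\<phi> + \<beta>))"
      by (simp add: \<theta>_def \<beta>_def field_simps)
    also have "\<dots> = sin \<phi> * cos \<beta> + cos \<phi> * sin \<beta>"
      by (simp add: cos_diff[of "pi / 2"] sin_add)
    also have "\<dots> = ((1 + r) / (1 - r) + 1) * (cos \<phi> * sin \<beta>)"
      unfolding prod by (simp add: algebra_simps)
    also have "(1 + r) / (1 - r) + 1 = 2 / (1 - r)"
      using assms by (simp add: field_simps)
    finally show ?thesis .
  qed
  show "cos ((\<theta> + \<alpha>) / 2) / cos ((\<theta> - \<alpha>) / 2) = r"
    unfolding num den using assms pos cos by simp
  have "cos ((\<theta> + \<alpha>) / 2) \<noteq> 0" "cos ((\<theta> - \<alpha>) / 2) \<noteq> 0"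
    unfolding num den using assms pos cos by simp_all
  then have "\<theta> + \<alpha> \<noteq> pi" "\<theta> - \<alpha> \<noteq> pi"
    by auto
  then show "\<theta> \<in> admissible_angles \<alpha>"
    using \<phi> by (simp add: admissible_angles_def \<theta>_def)
qed

lemma edge_ratio_admissible:
  assumes "0 < \<alpha>" "\<alpha> < pi" "\<theta> \<in> admissible_angles \<alpha>"
  shows "cos ((\<theta> + \<alpha>) / 2) / cos ((\<theta> - \<alpha>) / 2) \<noteq> 0"
    and "cos ((\<theta> + \<alpha>) / 2) / cos ((\<theta> - \<alpha>) / 2) \<noteq> 1"
proof -
  have \<theta>: "0 < \<theta>" "\<theta> < 2 * pi" "\<theta> - \<alpha> \<noteq> pi" "\<theta> + \<alpha> \<noteq> pi"
    using assms by (auto simp: admissible_angles_def)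
  (* The only zero of the cosine in (-pi/2, 3 pi/2) is pi/2. *)
  have nz: "cos x \<noteq> 0" if "- (pi / 2) < x" "x < 3 * (pi / 2)" "x \<noteq> pi / 2" for x :: real
  proof (cases "x < pi / 2")
    case True
    then show ?thesis
      using that cos_gt_zero_pi[of x] by simp
  next
    case False
    then show ?thesis
      using that cos_gt_zero_pi[of "x - pi"] by (simp add: cos_diff)
  qed
  have "cos ((\<theta> + \<alpha>) / 2) \<noteq> 0" "cos ((\<theta> - \<alpha>) / 2) \<noteq> 0"
    using \<theta> assms by (intro nz; simp)+
  moreover have "cos ((\<theta> - \<alpha>) / 2) - cos ((\<theta> + \<alpha>) / 2) = 2 * (sin (\<theta> / 2) * sin (\<alpha> / 2))"
    by (simp add: add_divide_distrib diff_divide_distrib cos_add cos_diff)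
  moreover have "sin (\<theta> / 2) > 0" "sin (\<alpha> / 2) > 0"
    using \<theta> assms by (auto intro!: sin_gt_zero)
  ultimately show "cos ((\<theta> + \<alpha>) / 2) / cos ((\<theta> - \<alpha>) / 2) \<noteq> 0"
    and "cos ((\<theta> + \<alpha>) / 2) / cos ((\<theta> - \<alpha>) / 2) \<noteq> 1"
    by (auto simp: divide_eq_1_iff)
qed

text \<open>The puncture is the boundary value at the excluded angle \<open>\<theta> = 0\<close>.\<close>
lemma strip_edge_image:
  assumes "0 < \<alpha>" "\<alpha> < pi"
  shows "strip_edge \<alpha> ` admissible_angles \<alpha> =
    {w. Re w = (\<alpha> - pi) / (2 * sin \<alpha>) \<or> Re w = \<alpha> / (2 * sin \<alpha>)} -
    {complex_of_real (\<alpha> / (2 * sin \<alpha>))}" (is "_ = ?E")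
proof
  have s: "sin \<alpha> > 0"
    using assms by (simp add: sin_gt_zero)
  show "strip_edge \<alpha> ` admissible_angles \<alpha> \<subseteq> ?E"
  proof
    fix w
    assume "w \<in> strip_edge \<alpha> ` admissible_angles \<alpha>"
    then obtain \<theta> where \<theta>: "\<theta> \<in> admissible_angles \<alpha>" and w: "w = strip_edge \<alpha> \<theta>"
      by blast
    define r where "r = cos ((\<theta> + \<alpha>) / 2) / cos ((\<theta> - \<alpha>) / 2)"
    have r: "r \<noteq> 0" "r \<noteq> 1"
      using edge_ratio_admissible[OF assms \<theta>] by (auto simp: r_def)
    have "w = Complex ((if 0 < r then \<alpha> else \<alpha> - pi) / (2 * sin \<alpha>)) (- ln \<bar>r\<bar> / (2 * sin \<alpha>))"
      unfolding w r_def using r by (intro strip_edge_eq assms) (simp add: r_def)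
    then show "w \<in> ?E"
      using r s by (auto simp: complex_eq_iff)
  qed
  show "?E \<subseteq> strip_edge \<alpha> ` admissible_angles \<alpha>"
  proof
    fix w
    assume w: "w \<in> ?E"
    (* Solve strip_edge_eq for the ratio: the imaginary part gives its modulus, the edge its sign. *)
    define m where "m = exp (- (2 * sin \<alpha> * Im w))"
    define r where "r = (if Re w = \<alpha> / (2 * sin \<alpha>) then m else - m)"
    have m: "m > 0"
      by (simp add: m_def)
    have neq: "(\<alpha> - pi) / (2 * sin \<alpha>) \<noteq> \<alpha> / (2 * sin \<alpha>)"
      using s by simp
    have "r \<noteq> 1"
    proof
      assume "r = 1"
      then have "Re w = \<alpha> / (2 * sin \<alpha>)" "m = 1"
        using m by (auto simp: r_def split: if_splits)
      then show False
        using w s by (auto simp: m_def complex_eq_iff)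
    qed
    moreover have "r \<noteq> 0"
      using m by (simp add: r_def)
    ultimately obtain \<theta> where \<theta>: "\<theta> \<in> admissible_angles \<alpha>"
      and eq: "cos ((\<theta> + \<alpha>) / 2) / cos ((\<theta> - \<alpha>) / 2) = r"
      using edge_ratio_surj[OF assms] by blast
    have "strip_edge \<alpha> \<theta> =
        Complex ((if 0 < r then \<alpha> else \<alpha> - pi) / (2 * sin \<alpha>)) (- ln \<bar>r\<bar> / (2 * sin \<alpha>))"
      using strip_edge_eq[OF assms, of \<theta>] \<open>r \<noteq> 0\<close> by (simp add: eq)
    moreover have "\<bar>r\<bar> = m"
      using m by (simp add: r_def)
    moreover have "- ln m / (2 * sin \<alpha>) = Im w"
      using s by (simp add: m_def)
    moreover have "(if 0 < r then \<alpha> else \<alpha> - pi) / (2 * sin \<alpha>) = Re w"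
      using w m neq by (auto simp: r_def)
    ultimately have "strip_edge \<alpha> \<theta> = w"
      by simp
    then show "w \<in> strip_edge \<alpha> ` admissible_angles \<alpha>"
      using \<theta> by blast
  qed
qed

section \<open>Holomorphic functions avoiding the punctured edges of a strip\<close>

text \<open>By the open mapping theorem a point that a nonconstant holomorphic function hits comes
  with nearby points on the vertical line through it, so deleting one point \<open>q\<close> from a
  forbidden vertical line changes nothing.\<close>
lemma holomorphic_avoids_line:
  assumes hol: "F holomorphic_on U" and U: "open U" "connected U"
    and z0: "z0 \<in> U" "Re (F z0) \<noteq> c"
    and avoid: "\<And>z. z \<in> U \<Longrightarrow> Re (F z) = c \<Longrightarrow> F z = q"
    and z: "z \<in> U"
  shows "Re (F z) \<noteq> c"
proof
  assume c: "Re (F z) = c"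
  then have q: "F z = q"
    using avoid z by blast
  have "\<not> F constant_on U"
    using z0 z c unfolding constant_on_def by metis
  then have "open (F ` U)"
    using open_mapping_thm[OF hol U U(1) order_refl] by blast
  moreover have "q \<in> F ` U"
    using q z by blast
  ultimately obtain e where e: "e > 0" "ball q e \<subseteq> F ` U"
    by (auto simp: open_contains_ball)
  have "q + \<i> * complex_of_real (e / 2) \<in> ball q e"
    using e by (simp add: dist_norm norm_mult)
  then obtain y where y: "y \<in> U" "F y = q + \<i> * complex_of_real (e / 2)"
    using e(2) by force
  then have "Re (F y) = c"
    using c q by simp
  then have "F y = q"
    using avoid y by blast
  then show False
    using y(2) e(1) by simp
qed

lemma holomorphic_stays_in_strip:
  assumes hol: "F holomorphic_on U" and U: "open U" "connected U"
    and z0: "z0 \<in> U" "a < Re (F z0)" "Re (F z0) < b"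
    and avoid: "\<And>z. z \<in> U \<Longrightarrow> Re (F z) = a \<or> Re (F z) = b \<Longrightarrow> F z = q"
    and z: "z \<in> U"
  shows "a < Re (F z) \<and> Re (F z) < b"
proof -
  have "connected ((\<lambda>z. Re (F z)) ` U)"
    using U hol by (intro connected_continuous_image continuous_intros holomorphic_on_imp_continuous_on)
  then have conn: "x \<in> (\<lambda>z. Re (F z)) ` U" if "Re (F u) \<le> x" "x \<le> Re (F v)" "u \<in> U" "v \<in> U" for x u v
    using that connectedD_interval[of "(\<lambda>z. Re (F z)) ` U"] by blast
  have "a \<notin> (\<lambda>z. Re (F z)) ` U"
    using holomorphic_avoids_line[OF hol U z0(1), of a q] z0 avoid by fastforce
  moreover have "b \<notin> (\<lambda>z. Re (F z)) ` U"
    using holomorphic_avoids_line[OF hol U z0(1), of b q] z0 avoid by fastforce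
  ultimately show ?thesis
    using conn[of z a z0] conn[of z0 b z] z z0 by linarith
qed

section \<open>The quotient and the convolution for normalised univalent functions\<close>

lemma class_A_coefficients:
  assumes "f \<in> class_A"
  obtains a where "a 0 = 0" "a 1 = 1" "\<And>z. z \<in> ball 0 1 \<Longrightarrow> (\<lambda>n. a n * z ^ n) sums f z"
  using assms by (auto simp: class_A_def)

lemma class_A_deriv_0:
  assumes "f \<in> class_A"
  shows "deriv f 0 = 1"
proof -
  obtain a where a: "a 0 = 0" "a 1 = 1" "\<And>z. z \<in> ball 0 1 \<Longrightarrow> (\<lambda>n. a n * z ^ n) sums f z"
    using class_A_coefficients[OF assms] by blast
  show ?thesis
    using fps_nth_fps_expansion_sums[OF a(3), of 1] a(2) by (simp add: fps_expansion_def)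
qed

lemma class_A_0:
  assumes "f \<in> class_A"
  shows "f 0 = 0"
proof -
  obtain a where a: "a 0 = 0" "\<And>z. z \<in> ball 0 1 \<Longrightarrow> (\<lambda>n. a n * z ^ n) sums f z"
    using class_A_coefficients[OF assms] by blast
  have "(\<lambda>n. a n * 0 ^ n) sums a 0"
    by (rule powser_sums_zero)
  then show ?thesis
    using a(1) a(2)[of 0] sums_unique2 by auto
qed

lemma class_A_nonzero:
  assumes "f \<in> class_A" "z \<in> ball 0 1" "z \<noteq> 0"
  shows "f z \<noteq> 0"
  using assms inj_onD[of f "ball 0 1" z 0] class_A_0[OF assms(1)] by (auto simp: class_A_def)

text \<open>The quotient is \<open>f' / g\<close> with \<open>g\<close> the zero-free holomorphic extension of \<open>f z / z\<close>.\<close>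
lemma starlike_quotient_holomorphic:
  assumes "f \<in> class_A"
  shows "starlike_quotient f holomorphic_on ball 0 1"
proof -
  define g where "g = (\<lambda>z. if z = 0 then deriv f 0 else f z / z)"
  have f: "f holomorphic_on ball 0 1"
    using assms by (auto simp: class_A_def intro: analytic_imp_holomorphic)
  have "g holomorphic_on ball 0 1"
    by (rule pole_theorem_open_0[OF f open_ball, of 0])
      (use class_A_0[OF assms] in \<open>auto simp: g_def\<close>)
  moreover have "g z \<noteq> 0" if "z \<in> ball 0 1" for z
    using that class_A_nonzero[OF assms] class_A_deriv_0[OF assms] by (auto simp: g_def)
  ultimately have "(\<lambda>z. deriv f z / g z) holomorphic_on ball 0 1"
    using f by (intro holomorphic_intros) auto
  moreover have "starlike_quotient f = (\<lambda>z. deriv f z / g z)"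
    using class_A_deriv_0[OF assms] by (auto simp: starlike_quotient_def g_def fun_eq_iff)
  ultimately show ?thesis
    by simp
qed

lemma sums_z_deriv:
  fixes a :: "nat \<Rightarrow> complex"
  assumes a: "\<And>z. z \<in> ball 0 1 \<Longrightarrow> (\<lambda>n. a n * z ^ n) sums f z" and z: "z \<in> ball 0 1"
  shows "(\<lambda>n. of_nat n * a n * z ^ n) sums (z * deriv f z)"
proof -
  have summ: "summable (\<lambda>n. a n * x ^ n)" if "norm x < 1" for x
    using a that by (auto simp: sums_iff)
  have "((\<lambda>x. \<Sum>n. a n * x ^ n) has_field_derivative (\<Sum>n. diffs a n * z ^ n)) (at z)"
    using summ z by (intro termdiffs_strong') auto
  then have "(f has_field_derivative (\<Sum>n. diffs a n * z ^ n)) (at z)"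
    by (rule has_field_derivative_transform_within_open[of _ _ _ "ball 0 1"])
      (use a z in \<open>auto simp: sums_iff\<close>)
  then have d: "deriv f z = (\<Sum>n. diffs a n * z ^ n)"
    by (rule DERIV_imp_deriv)
  have "summable (\<lambda>n. diffs a n * z ^ n)"
    using summ z by (intro termdiff_converges[of z 1]) auto
  then have "(\<lambda>n. of_nat n * a n * z ^ (n - Suc 0)) sums deriv f z"
    unfolding d by (rule diffs_equiv)
  then have "(\<lambda>n. z * (of_nat n * a n * z ^ (n - Suc 0))) sums (z * deriv f z)"
    by (rule sums_mult)
  moreover have "z * (of_nat n * a n * z ^ (n - Suc 0)) = of_nat n * a n * z ^ n" for n
    by (cases n) auto
  ultimately show ?thesis
    by simp
qed

text \<open>The coefficients follow one formula from \<open>n = 1\<close> on; both fractions vanish at \<open>0\<close>, so the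
  constant term breaks it, which is harmless for convolution with a function whose own constant
  term is \<open>0\<close>.\<close>
lemma kernel_sums:
  fixes c w :: complex
  assumes "w \<in> ball 0 1"
  shows "(\<lambda>n. (if n = 0 then 0 else of_nat n - 1 - c) * w ^ n) sums
    (w\<^sup>2 / (1 - w)\<^sup>2 - w / (1 - w) * c)"
proof -
  have w: "norm w < 1" "w \<noteq> 1"
    using assms by auto
  have "(\<lambda>n. w * w ^ n) sums (w * (1 / (1 - w)))"
    using w by (intro sums_mult geometric_sums)
  moreover have "(\<lambda>n. w * (of_nat (Suc n) * w ^ n)) sums (w * (1 / (1 - w)\<^sup>2))"
    using w by (intro sums_mult geometric_deriv_sums)
  ultimately have "(\<lambda>n. w * (of_nat (Suc n) * w ^ n) - (1 + c) * (w * w ^ n)) sums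
      (w * (1 / (1 - w)\<^sup>2) - (1 + c) * (w * (1 / (1 - w))))"
    by (intro sums_diff sums_mult[of "\<lambda>n. w * w ^ n"])
  also have "(\<lambda>n. w * (of_nat (Suc n) * w ^ n) - (1 + c) * (w * w ^ n)) =
      (\<lambda>n. (if Suc n = 0 then 0 else of_nat (Suc n) - 1 - c) * w ^ Suc n)"
    by (auto simp: fun_eq_iff algebra_simps)
  also have "w * (1 / (1 - w)\<^sup>2) - (1 + c) * (w * (1 / (1 - w))) =
      w\<^sup>2 / (1 - w)\<^sup>2 - w / (1 - w) * c"
  proof -
    have "1 - w \<noteq> 0"
      using w by simp
    then show ?thesis
      by (simp add: divide_simps) (simp add: algebra_simps power2_eq_square)
  qed
  finally show ?thesis
    by (subst (asm) sums_Suc_iff) simp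
qed

lemma hadamard_product_kernel:
  assumes "f \<in> class_A" "z \<in> ball 0 1"
  shows "hadamard_product f (\<lambda>w. w\<^sup>2 / (1 - w)\<^sup>2 - w / (1 - w) * c) z =
    z * deriv f z - f z - c * f z"
proof -
  obtain a where a0: "a 0 = 0" and a: "\<And>z. z \<in> ball 0 1 \<Longrightarrow> (\<lambda>n. a n * z ^ n) sums f z"
    using class_A_coefficients[OF assms(1)] by blast
  have "(\<lambda>n. a n * (if n = 0 then 0 else of_nat n - 1 - c) * z ^ n) sums
      hadamard_product f (\<lambda>w. w\<^sup>2 / (1 - w)\<^sup>2 - w / (1 - w) * c) z"
    using a kernel_sums assms(2) by (rule hadamard_product_sums)
  moreover have "(\<lambda>n. of_nat n * a n * z ^ n - a n * z ^ n - c * (a n * z ^ n)) sums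
      (z * deriv f z - f z - c * f z)"
    using assms(2) by (intro sums_diff sums_mult sums_z_deriv a)
  moreover have "a n * (if n = 0 then 0 else of_nat n - 1 - c) * z ^ n =
      of_nat n * a n * z ^ n - a n * z ^ n - c * (a n * z ^ n)" for n
    using a0 by (simp add: algebra_simps)
  ultimately show ?thesis
    using sums_unique2 by simp
qed

lemma hadamard_product_kernel_eq_0_iff:
  assumes "f \<in> class_A" "z \<in> ball 0 1 - {0}"
  shows "hadamard_product f (\<lambda>w. w\<^sup>2 / (1 - w)\<^sup>2 - w / (1 - w) * c) z = 0 \<longleftrightarrow>
    starlike_quotient f z - 1 = c"
proof -
  have "f z \<noteq> 0"
    using class_A_nonzero[OF assms(1)] assms(2) by simp
  then show ?thesis
    using hadamard_product_kernel[OF assms(1), of z c] assms(2)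
    by (auto simp: starlike_quotient_def field_simps)
qed

section \<open>The convolution characterisation\<close>

theorem theorem2:
  fixes f :: "complex \<Rightarrow> complex" and \<alpha> :: real
  assumes "pi / 2 \<le> \<alpha>" and "\<alpha> < pi" and "f \<in> class_A"
  shows "f \<in> class_MS \<alpha> \<longleftrightarrow>
    (\<forall>\<theta>::real. 0 < \<theta> \<and> \<theta> < 2 * pi \<and> \<theta> - \<alpha> \<noteq> pi \<and> \<theta> + \<alpha> \<noteq> pi \<longrightarrow>
      (\<forall>z\<in>ball 0 1 - {0}.
        hadamard_product f
          (\<lambda>w. w\<^sup>2 / (1 - w)\<^sup>2 - w / (1 - w) * (1 / (2 * \<i> * complex_of_real (sin \<alpha>)) *
             Ln ((1 + exp (\<i> * complex_of_real (\<theta> + \<alpha>))) /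
                 (1 + exp (\<i> * complex_of_real (\<theta> - \<alpha>)))))) z \<noteq> 0))"
    (is "_ \<longleftrightarrow> ?R")
proof -
  define F where "F z = starlike_quotient f z - 1" for z
  define l where "l = (\<alpha> - pi) / (2 * sin \<alpha>)"
  define u where "u = \<alpha> / (2 * sin \<alpha>)"
  have \<alpha>: "0 < \<alpha>" "\<alpha> < pi"
    using assms pi_half_gt_zero by linarith+
  then have s: "sin \<alpha> > 0"
    by (simp add: sin_gt_zero)
  have lu: "l < 0" "0 < u"
    using \<alpha> s by (auto simp: l_def u_def divide_neg_pos)
  have F0: "F 0 = 0"
    by (simp add: F_def starlike_quotient_def)
  have hol: "F holomorphic_on ball 0 1"
    unfolding F_def using assms(3) by (intro holomorphic_intros starlike_quotient_holomorphic)
  have kernel: "hadamard_product f (\<lambda>w. w\<^sup>2 / (1 - w)\<^sup>2 - w / (1 - w) * strip_edge \<alpha> \<theta>) z = 0 \<longleftrightarrow>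
      F z = strip_edge \<alpha> \<theta>" if "z \<in> ball 0 1 - {0}" for \<theta> z
    unfolding F_def using assms(3) that by (rule hadamard_product_kernel_eq_0_iff)
  have "?R \<longleftrightarrow> (\<forall>\<theta>\<in>admissible_angles \<alpha>. \<forall>z\<in>ball 0 1 - {0}. F z \<noteq> strip_edge \<alpha> \<theta>)"
    unfolding strip_edge_def[symmetric] admissible_angles_def using kernel by blast
  also have "\<dots> \<longleftrightarrow> (\<forall>z\<in>ball 0 1 - {0}. F z \<notin> strip_edge \<alpha> ` admissible_angles \<alpha>)"
    by blast
  also have "\<dots> \<longleftrightarrow> (\<forall>z\<in>ball 0 1. Re (F z) = l \<or> Re (F z) = u \<longrightarrow> F z = of_real u)"
    using F0 lu unfolding strip_edge_image[OF \<alpha>] l_def[symmetric] u_def[symmetric]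
    by auto
  also have "\<dots> \<longleftrightarrow> (\<forall>z\<in>ball 0 1. l < Re (F z) \<and> Re (F z) < u)"
  proof
    assume *: "\<forall>z\<in>ball 0 1. Re (F z) = l \<or> Re (F z) = u \<longrightarrow> F z = of_real u"
    have "l < Re (F z) \<and> Re (F z) < u" if "z \<in> ball 0 1" for z
      using hol * that lu F0 by (intro holomorphic_stays_in_strip[of F "ball 0 1" 0 _ _ "of_real u"]) auto
    then show "\<forall>z\<in>ball 0 1. l < Re (F z) \<and> Re (F z) < u"
      by blast
  qed fastforce
  also have "\<dots> \<longleftrightarrow> f \<in> class_MS \<alpha>"
    using assms(3) unfolding class_MS_def F_def l_def u_def by (auto simp: algebra_simps)
  finally show ?thesis
    by simp
qed

end
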